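(* Let $G=(V,E)$ be a graph with $n$ nodes and planted bisection $V_1,V_2$, let $G_1=G[V_1]$, $G_2=G[V_2]$, and let $G_0=(V,E_0)$ with $E_0$ the set of edges of $G$ between $V_1$ and $V_2$. Let $d_{\mathrm{in}}$ be the minimum node degree of $G_1\cup G_2$ and let $d_{\mathrm{out}}$ be the maximum node degree of $G_0$. Assume that $G_1$ and $G_2$ contain $d_{\mathrm{in}}$-regular subgraphs on the same node set (i.e. for each $i\in\{1,2\}$, $G_i$ has a $d_{\mathrm{in}}$-regular subgraph with node set $V_i$), and assume that $G_0$ is a subgraph of a $d_{\mathrm{out}}$-regular bipartite graph with the same bipartition $V_1,V_2$. Then the LP relaxation recovers the planted bisection if $d_{\mathrm{in}}-d_{\mathrm{out}}\ge\frac n4$.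
   Context: Graphs are finite, simple and undirected, with $V=\{1,\dots,n\}$. A bisection of $V$ is a partition of $V$ into two subsets of equal cardinality (so $n$ is even); a fixed bisection $V_1,V_2$ is called the planted bisection. $G[U]$ denotes the subgraph induced by $U$. The LP relaxation (metric relaxation of the minimum bisection problem) associated with $G$ is the following linear program in $x\in\mathbb R^{\binom n2}$, with coordinates $x_{ij}$, $1\le i<j\le n$, and the convention $x_{ji}:=x_{ij}$: $$\min\ \sum_{1\le i<j\le n}a_{ij}x_{ij}$$ subject to $x_{ij}\le x_{ik}+x_{jk}$ for all distinct $i,j,k\in\{1,\dots,n\}$ with $i<j$; $x_{ij}+x_{ik}+x_{jk}\le 2$ for all $1\le i<j<k\le n$; and $\sum_{1\le i<j\le n}x_{ij}=n^2/4$. Here $a_{ij}=1$ if $\{i,j\}\in E$ and $a_{ij}=0$ otherwise. The cut vector corresponding to the planted bisection is $\bar x\in\{0,1\}^{\binom n2}$ with $\bar x_{ij}=0$ if $i,j$ are in the same set of the bisection and $\bar x_{ij}=1$ otherwise. The LP relaxation recovers the planted bisection if $\bar x$ is its unique optimal solution. *)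

theory Defs
  imports Complex_Main "HOL-Library.Ramsey" "HOL-Library.FuncSet"
begin

text \<open>
  A graph is a pair of a node set and an edge set; \<open>[V]\<^bsup>2\<^esup>\<close> is the library's
  notation for the set of two-element subsets of \<open>V\<close>.
\<close>

type_synonym 'a ugraph = "'a set \<times> 'a set set"

abbreviation verts :: "'a ugraph \<Rightarrow> 'a set" where
  "verts G \<equiv> fst G"

abbreviation edges :: "'a ugraph \<Rightarrow> 'a set set" where
  "edges G \<equiv> snd G"

definition simple_graph :: "'a ugraph \<Rightarrow> bool" where
  "simple_graph G \<longleftrightarrow> finite (verts G) \<and> edges G \<subseteq> [verts G]\<^bsup>2\<^esup>"

definition subgraph :: "'a ugraph \<Rightarrow> 'a ugraph \<Rightarrow> bool" where
  "subgraph H G \<longleftrightarrow> simple_graph H \<and> simple_graph G \<and>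
     verts H \<subseteq> verts G \<and> edges H \<subseteq> edges G"

definition induced_subgraph :: "'a ugraph \<Rightarrow> 'a set \<Rightarrow> 'a ugraph" where
  "induced_subgraph G U = (U, {e \<in> edges G. e \<subseteq> U})"

definition graph_union :: "'a ugraph \<Rightarrow> 'a ugraph \<Rightarrow> 'a ugraph" where
  "graph_union G H = (verts G \<union> verts H, edges G \<union> edges H)"

definition between_graph :: "'a ugraph \<Rightarrow> 'a set \<Rightarrow> 'a set \<Rightarrow> 'a ugraph" where
  "between_graph G A B = (verts G, {e \<in> edges G. \<exists>a\<in>A. \<exists>b\<in>B. e = {a, b}})"

definition degree :: "'a ugraph \<Rightarrow> 'a \<Rightarrow> nat" where
  "degree G v = card {e \<in> edges G. v \<in> e}"

definition min_degree :: "'a ugraph \<Rightarrow> nat" where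
  "min_degree G = Min (degree G ` verts G)"

definition max_degree :: "'a ugraph \<Rightarrow> nat" where
  "max_degree G = Max (degree G ` verts G)"

definition regular :: "nat \<Rightarrow> 'a ugraph \<Rightarrow> bool" where
  "regular d G \<longleftrightarrow> (\<forall>v\<in>verts G. degree G v = d)"

definition bipartite_with :: "'a set \<Rightarrow> 'a set \<Rightarrow> 'a ugraph \<Rightarrow> bool" where
  "bipartite_with A B G \<longleftrightarrow> simple_graph G \<and> verts G = A \<union> B \<and> A \<inter> B = {} \<and>
     (\<forall>e\<in>edges G. \<exists>a\<in>A. \<exists>b\<in>B. e = {a, b})"

definition bisection :: "'a set \<Rightarrow> 'a set \<Rightarrow> 'a set \<Rightarrow> bool" where
  "bisection V A B \<longleftrightarrow> A \<union> B = V \<and> A \<inter> B = {} \<and> A \<noteq> {} \<and> B \<noteq> {} \<and> card A = card B"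

text \<open>
  The coordinates of \<open>\<real>\<close> to the power \<open>n choose 2\<close> are indexed by the unordered pairs
  \<open>{i, j}\<close>, which builds in the convention \<open>x\<^sub>j\<^sub>i = x\<^sub>i\<^sub>j\<close>. Vectors are extensional
  functions, so equality of functions is equality of vectors.
\<close>

definition pair_vectors :: "nat \<Rightarrow> (nat set \<Rightarrow> real) set" where
  "pair_vectors n = [{1..n}]\<^bsup>2\<^esup> \<rightarrow>\<^sub>E UNIV"

definition lp_feasible :: "nat \<Rightarrow> (nat set \<Rightarrow> real) set" where
  "lp_feasible n = {x \<in> pair_vectors n.
     (\<forall>i\<in>{1..n}. \<forall>j\<in>{1..n}. \<forall>k\<in>{1..n}. i < j \<and> k \<noteq> i \<and> k \<noteq> j \<longrightarrow>
        x {i, j} \<le> x {i, k} + x {j, k}) \<and>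
     (\<forall>i\<in>{1..n}. \<forall>j\<in>{1..n}. \<forall>k\<in>{1..n}. i < j \<and> j < k \<longrightarrow>
        x {i, j} + x {i, k} + x {j, k} \<le> 2) \<and>
     (\<Sum>e\<in>[{1..n}]\<^bsup>2\<^esup>. x e) = (real n)\<^sup>2 / 4}"

definition lp_objective :: "nat \<Rightarrow> nat ugraph \<Rightarrow> (nat set \<Rightarrow> real) \<Rightarrow> real" where
  "lp_objective n G x = (\<Sum>e\<in>[{1..n}]\<^bsup>2\<^esup>. (if e \<in> edges G then 1 else 0) * x e)"

definition lp_optimal :: "nat \<Rightarrow> nat ugraph \<Rightarrow> (nat set \<Rightarrow> real) \<Rightarrow> bool" where
  "lp_optimal n G x \<longleftrightarrow> x \<in> lp_feasible n \<and>
     (\<forall>y\<in>lp_feasible n. lp_objective n G x \<le> lp_objective n G y)"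

definition cut_vector :: "nat \<Rightarrow> nat set \<Rightarrow> nat set \<Rightarrow> nat set \<Rightarrow> real" where
  "cut_vector n A B =
     (\<lambda>e\<in>[{1..n}]\<^bsup>2\<^esup>. if e \<subseteq> A \<or> e \<subseteq> B then 0 else 1)"

definition lp_recovers :: "nat \<Rightarrow> nat ugraph \<Rightarrow> nat set \<Rightarrow> nat set \<Rightarrow> bool" where
  "lp_recovers n G A B \<longleftrightarrow>
     lp_optimal n G (cut_vector n A B) \<and> (\<forall>y. lp_optimal n G y \<longrightarrow> y = cut_vector n A B)"

end

theory Submission
  imports Defs
begin

text \<open>
  Switching along the planted cut, i.e. passing from \<open>x\<close> to \<open>w = \<bar>x - x\<^sub>0\<bar>\<close> with \<open>x\<^sub>0\<close> the cut
  vector, turns the triangle and perimeter inequalities into the statement that \<open>w\<close> is a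
  semimetric, and the equation on the sum of all coordinates into the equality of the total weight
  \<open>C\<close> across the cut and the total weight inside the parts. With \<open>m = n / 2\<close>, \<open>d\<close> and \<open>r\<close> the inner
  and outer degree, and \<open>W\<close>, \<open>W\<^sub>0\<close> the weights of the inner and outer regular graphs, two nodes that
  are not adjacent in an inner graph have at least \<open>k = 2 * d - m + 2\<close> common neighbours,
  so the triangle inequality gives \<open>k * C \<le> m * W\<close>. Rerouting every outer edge through the
  inner neighbours of its ends gives \<open>d * W\<^sub>0 \<le> r * W + r * C\<close>. As \<open>k \<ge> 2 * r + 2\<close> and \<open>r < d\<close>,
  these force \<open>W\<^sub>0 < W\<close> unless \<open>w = 0\<close>.
\<close>

section \<open>Neighbourhoods and double counting of edge weights\<close>

text \<open>Takes a bare edge set instead of a graph, so that it also covers complete edge sets and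
  \<open>cross_pairs\<close>.\<close>

definition nbrs :: "'a set set \<Rightarrow> 'a \<Rightarrow> 'a set" where
  "nbrs E v = {u. {v, u} \<in> E}"

lemma nbrs_sym: "u \<in> nbrs E v \<longleftrightarrow> v \<in> nbrs E u"
  by (simp add: nbrs_def insert_commute)

lemma nbrs_subset: "E \<subseteq> [V]\<^bsup>2\<^esup> \<Longrightarrow> nbrs E v \<subseteq> V - {v}"
  by (auto simp: nbrs_def nsets_def)

lemma bij_betw_nbrs:
  assumes "E \<subseteq> [V]\<^bsup>2\<^esup>"
  shows "bij_betw (\<lambda>u. {v, u}) (nbrs E v) {e \<in> E. v \<in> e}"
  unfolding bij_betw_def
proof
  show "inj_on (\<lambda>u. {v, u}) (nbrs E v)"
    by (auto simp: inj_on_def doubleton_eq_iff)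
  have "e \<in> (\<lambda>u. {v, u}) ` nbrs E v" if e: "e \<in> E" "v \<in> e" for e
  proof -
    have "card e = 2"
      using e assms by (auto simp: nsets_def)
    then obtain a b where "e = {a, b}"
      by (auto simp: card_2_iff)
    with e(2) have "\<exists>u. e = {v, u}"
      by auto
    with e(1) show ?thesis
      by (auto simp: nbrs_def)
  qed
  then show "(\<lambda>u. {v, u}) ` nbrs E v = {e \<in> E. v \<in> e}"
    by (auto simp: nbrs_def)
qed

lemma card_nbrs:
  assumes "simple_graph G"
  shows "card (nbrs (edges G) v) = degree G v"
  using bij_betw_same_card[OF bij_betw_nbrs[of "edges G" "verts G" v]] assms
  by (simp add: simple_graph_def degree_def)

text \<open>Double counting of the incidences between \<open>A\<close> and \<open>E\<close>: an edge
  is met once for each of its ends in \<open>A\<close>. The cases used are \<open>A\<close> the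
  whole node set (factor 2) and \<open>A\<close> one side of a bipartition (factor 1).\<close>

lemma sum_nbrs:
  fixes f :: "'a set \<Rightarrow> real"
  assumes "finite V" "E \<subseteq> [V]\<^bsup>2\<^esup>" "finite A"
  shows "(\<Sum>a\<in>A. \<Sum>u\<in>nbrs E a. f {a, u}) = (\<Sum>e\<in>E. real (card (A \<inter> e)) * f e)"
proof -
  have "finite E"
    using assms finite_imp_finite_nsets finite_subset by metis
  have "(\<Sum>u\<in>nbrs E a. f {a, u}) = (\<Sum>e\<in>{e \<in> E. a \<in> e}. f e)" for a
    using sum.reindex_bij_betw[OF bij_betw_nbrs[OF assms(2)]] .
  then have "(\<Sum>a\<in>A. \<Sum>u\<in>nbrs E a. f {a, u}) = (\<Sum>a\<in>A. \<Sum>e\<in>{e \<in> E. a \<in> e}. f e)"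
    by simp
  also have "\<dots> = (\<Sum>e\<in>E. \<Sum>a\<in>{a \<in> A. a \<in> e}. f e)"
    by (rule sum.swap_restrict) (use \<open>finite E\<close> assms in auto)
  also have "\<dots> = (\<Sum>e\<in>E. real (card (A \<inter> e)) * f e)"
    by (simp add: Int_def)
  finally show ?thesis .
qed

lemma sum_nbrs_nsets:
  fixes f :: "'a set \<Rightarrow> real"
  assumes "finite V" "E \<subseteq> [V]\<^bsup>2\<^esup>"
  shows "(\<Sum>a\<in>V. \<Sum>u\<in>nbrs E a. f {a, u}) = 2 * (\<Sum>e\<in>E. f e)"
proof -
  have "V \<inter> e = e \<and> card e = 2" if "e \<in> E" for e
    using that assms by (auto simp: nsets_def)
  then show ?thesis
    by (simp add: sum_nbrs[OF assms assms(1)] sum_distrib_left)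
qed

section \<open>Pairs across a bipartition\<close>

text \<open>The edge set of the complete bipartite graph with sides \<open>A\<close> and
  \<open>B\<close>.\<close>

definition cross_pairs :: "'a set \<Rightarrow> 'a set \<Rightarrow> 'a set set" where
  "cross_pairs A B = {{a, b} | a b. a \<in> A \<and> b \<in> B}"

lemma doubleton_in_cross_pairs [simp]:
  "{i, j} \<in> cross_pairs A B \<longleftrightarrow> i \<in> A \<and> j \<in> B \<or> i \<in> B \<and> j \<in> A"
  unfolding cross_pairs_def by (simp add: doubleton_eq_iff) blast

lemma cross_pairsE:
  assumes "e \<in> cross_pairs A B"
  obtains a b where "e = {a, b}" "a \<in> A" "b \<in> B"
  using assms unfolding cross_pairs_def by blast

lemma cross_pairs_commute: "cross_pairs A B = cross_pairs B A"
  by (auto elim!: cross_pairsE)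

lemma cross_pairs_subset: "A \<inter> B = {} \<Longrightarrow> cross_pairs A B \<subseteq> [A \<union> B]\<^bsup>2\<^esup>"
  by (auto simp: nsets_def card_insert_if elim!: cross_pairsE)

lemma sum_nbrs_cross:
  fixes f :: "'a set \<Rightarrow> real"
  assumes "finite A" "finite B" "A \<inter> B = {}" "E \<subseteq> cross_pairs A B"
  shows "(\<Sum>a\<in>A. \<Sum>u\<in>nbrs E a. f {a, u}) = (\<Sum>e\<in>E. f e)"
proof -
  have "card (A \<inter> e) = 1" if "e \<in> E" for e
  proof -
    have "e \<in> cross_pairs A B"
      using that assms(4) by blast
    then obtain a b where "e = {a, b}" "a \<in> A" "b \<in> B"
      by (rule cross_pairsE)
    then have "A \<inter> e = {a}"
      using assms by auto
    then show ?thesis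
      by simp
  qed
  moreover have "E \<subseteq> [A \<union> B]\<^bsup>2\<^esup>"
    using assms cross_pairs_subset by blast
  ultimately show ?thesis
    using sum_nbrs[of "A \<union> B" E A f] assms by simp
qed

lemma sum_all_cross:
  fixes f :: "'a set \<Rightarrow> real"
  assumes "finite A" "finite B" "A \<inter> B = {}"
  shows "(\<Sum>a\<in>A. \<Sum>b\<in>B. f {a, b}) = (\<Sum>e\<in>cross_pairs A B. f e)"
proof -
  have "nbrs (cross_pairs A B) a = B" if "a \<in> A" for a
    using that assms by (auto simp: nbrs_def)
  then show ?thesis
    using sum_nbrs_cross[OF assms, of "cross_pairs A B" f] by simp
qed

text \<open>The diagonal terms are \<open>f {a, a} = f {a} = 0\<close>, and every other pair occurs
  in both orders.\<close>

lemma sum_all_pairs: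
  fixes f :: "'a set \<Rightarrow> real"
  assumes "finite V" "\<And>v. v \<in> V \<Longrightarrow> f {v} = 0"
  shows "(\<Sum>a\<in>V. \<Sum>b\<in>V. f {a, b}) = 2 * (\<Sum>e\<in>[V]\<^bsup>2\<^esup>. f e)"
proof -
  have "nbrs ([V]\<^bsup>2\<^esup>) a = V - {a}" if "a \<in> V" for a
    using that by (auto simp: nbrs_def nsets_def)
  moreover have "(\<Sum>b\<in>V. f {a, b}) = (\<Sum>b\<in>V - {a}. f {a, b})" if "a \<in> V" for a
    using that assms by (simp add: sum.remove[of V a])
  ultimately show ?thesis
    using sum_nbrs_nsets[OF assms(1), of "[V]\<^bsup>2\<^esup>" f] by simp
qed

lemma nsets_Un_2:
  assumes "A \<inter> B = {}"
  shows "[A \<union> B]\<^bsup>2\<^esup> = [A]\<^bsup>2\<^esup> \<union> [B]\<^bsup>2\<^esup> \<union> cross_pairs A B" (is "?L = ?R")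
proof
  show "?L \<subseteq> ?R"
  proof
    fix e assume e: "e \<in> ?L"
    then obtain a b where "e = {a, b}" "a \<noteq> b" "a \<in> A \<union> B" "b \<in> A \<union> B"
      by (auto simp: nsets_def card_2_iff)
    then show "e \<in> ?R"
      by (auto simp: nsets_def)
  qed
  show "?R \<subseteq> ?L"
    using cross_pairs_subset[OF assms] by (auto simp: nsets_def)
qed

lemma nsets_disjoint_2:
  assumes "A \<inter> B = {}"
  shows "[A]\<^bsup>2\<^esup> \<inter> [B]\<^bsup>2\<^esup> = {}"
proof -
  have False if "e \<in> [A]\<^bsup>2\<^esup>" "e \<in> [B]\<^bsup>2\<^esup>" for e
  proof -
    have "e \<subseteq> A \<inter> B" "card e = 2"
      using that by (auto simp: nsets_def)
    then show False
      using assms by simp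
  qed
  then show ?thesis
    by blast
qed

lemma sum_nsets_Un:
  fixes f :: "'a set \<Rightarrow> real"
  assumes "finite A" "finite B" "A \<inter> B = {}"
  shows "(\<Sum>e\<in>[A \<union> B]\<^bsup>2\<^esup>. f e)
    = (\<Sum>e\<in>[A]\<^bsup>2\<^esup>. f e) + (\<Sum>e\<in>[B]\<^bsup>2\<^esup>. f e) + (\<Sum>e\<in>cross_pairs A B. f e)"
proof -
  have fin: "finite ([A]\<^bsup>2\<^esup>)" "finite ([B]\<^bsup>2\<^esup>)" "finite (cross_pairs A B)"
    using assms cross_pairs_subset[OF assms(3)] finite_imp_finite_nsets finite_subset
    by (metis finite_UnI)+
  have "[A]\<^bsup>2\<^esup> \<inter> [B]\<^bsup>2\<^esup> = {}"
    using assms(3) by (rule nsets_disjoint_2)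
  moreover have "([A]\<^bsup>2\<^esup> \<union> [B]\<^bsup>2\<^esup>) \<inter> cross_pairs A B = {}"
    using assms(3) by (auto simp: nsets_def elim!: cross_pairsE)
  ultimately show ?thesis
    using fin by (simp add: nsets_Un_2[OF assms(3)] sum.union_disjoint)
qed

section \<open>Semimetrics on pairs\<close>

text \<open>The convention \<open>w {v} = 0\<close> makes \<open>\<lambda>i j. w {i, j}\<close> a semimetric on all of \<open>V\<close>.\<close>

definition semimetric :: "'a set \<Rightarrow> ('a set \<Rightarrow> real) \<Rightarrow> bool" where
  "semimetric V w \<longleftrightarrow> (\<forall>v\<in>V. w {v} = 0) \<and>
     (\<forall>i\<in>V. \<forall>j\<in>V. \<forall>k\<in>V. w {i, j} \<le> w {i, k} + w {k, j})"

lemma semimetric_triangle: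
  "semimetric V w \<Longrightarrow> i \<in> V \<Longrightarrow> j \<in> V \<Longrightarrow> k \<in> V \<Longrightarrow> w {i, j} \<le> w {i, k} + w {k, j}"
  unfolding semimetric_def by blast

text \<open>Going from \<open>i\<close> to \<open>j\<close> and back gives
  \<open>0 = w {i, i}\<close> \<le> \<open>2 * w {i, j}\<close>.\<close>

lemma semimetric_nonneg:
  assumes "semimetric V w" "i \<in> V" "j \<in> V"
  shows "0 \<le> w {i, j}"
proof -
  have "w {i, i} \<le> w {i, j} + w {j, i}"
    using assms by (intro semimetric_triangle)
  then show ?thesis
    using assms by (simp add: semimetric_def insert_commute)
qed

lemma semimetric_nonneg_nsets:
  assumes "semimetric V w" "e \<in> [V]\<^bsup>2\<^esup>"
  shows "0 \<le> w e"
  using assms semimetric_nonneg[OF assms(1)] by (auto simp: nsets_def card_2_iff)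

lemma semimetric_mono: "semimetric V w \<Longrightarrow> A \<subseteq> V \<Longrightarrow> semimetric A w"
  unfolding semimetric_def by blast

section \<open>Weight inequalities for regular graphs\<close>

text \<open>Stated over the reals, so that the left side may be negative without truncation.\<close>

lemma card_Int_ge:
  assumes "finite U" "A \<subseteq> U" "B \<subseteq> U"
  shows "real (card A) + real (card B) - real (card U) \<le> real (card (A \<inter> B))"
proof -
  have "finite A" "finite B"
    using assms finite_subset by auto
  then have "card A + card B = card (A \<union> B) + card (A \<inter> B)"
    by (rule card_Un_Int)
  moreover have "card (A \<union> B) \<le> card U"
    using assms by (intro card_mono) auto
  ultimately show ?thesis
    by linarith
qed

text \<open>The triangle inequality is summed over all non-adjacent pairs and all their common
  neighbours. Each such pair has at least \<open>?k\<close> common neighbours, while an edge at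
  \<open>i\<close> is used for at most \<open>card V - 1 - d\<close> partners \<open>j\<close>, the
  non-neighbours of \<open>i\<close> collected in \<open>F i\<close>.\<close>

lemma inner_regular_weight:
  assumes w: "semimetric V w" and fin: "finite V" and E: "E \<subseteq> [V]\<^bsup>2\<^esup>"
    and reg: "\<And>v. v \<in> V \<Longrightarrow> card (nbrs E v) = d"
  shows "(2 * real d - real (card V) + 2) * (\<Sum>e\<in>[V]\<^bsup>2\<^esup>. w e) \<le> real (card V) * (\<Sum>e\<in>E. w e)"
proof -
  let ?N = "nbrs E" and ?k = "2 * real d - real (card V) + 2"
  define F where "F i = V - {i} - ?N i" for i
  note N = nbrs_subset[OF E]
  have finN: "finite (?N i)" "finite (F i)" for i
    using N fin finite_subset by (fastforce simp: F_def)+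
  have cardF: "real (card (F i)) = real (card V) - 1 - real d" if "i \<in> V" for i
  proof -
    have "card (V - {i}) = card (F i) + card (?N i)"
      unfolding F_def using N[of i] fin
      by (metis card_Diff_subset card_mono finN(1) finite_Diff le_add_diff_inverse2)
    then show ?thesis
      using reg[OF that] card.remove[OF fin that] by simp
  qed
  have common: "?k * w {i, j} \<le> (\<Sum>k\<in>?N i \<inter> ?N j. w {i, k} + w {k, j})"
    if i: "i \<in> V" and j: "j \<in> F i" for i j
  proof -
    have jV: "j \<in> V" "j \<noteq> i" "j \<notin> ?N i" "i \<notin> ?N j"
      using j nbrs_sym[of i E j] by (auto simp: F_def)
    \<comment> \<open>Since \<open>i\<close> and \<open>j\<close> are not adjacent, both
      neighbourhoods avoid both nodes; this is the source of the \<open>+ 2\<close> in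
      \<open>?k\<close>.\<close>
    have "?N i \<subseteq> V - {i, j}" "?N j \<subseteq> V - {i, j}"
      using N[of i] N[of j] jV by auto
    from card_Int_ge[OF _ this] have "2 * real d - real (card (V - {i, j})) \<le> real (card (?N i \<inter> ?N j))"
      using fin reg i jV by simp
    moreover have "real (card (V - {i, j})) = real (card V) - 2"
    proof -
      have "card {i, j} = 2"
        using jV by simp
      moreover have "card {i, j} \<le> card V"
        using fin i jV by (intro card_mono) auto
      ultimately show ?thesis
        using fin i jV by (simp add: card_Diff_subset)
    qed
    ultimately have "?k \<le> real (card (?N i \<inter> ?N j))"
      by simp
    then have "?k * w {i, j} \<le> real (card (?N i \<inter> ?N j)) * w {i, j}"
      using semimetric_nonneg[OF w i jV(1)] by (rule mult_right_mono)
    also have "\<dots> = (\<Sum>k\<in>?N i \<inter> ?N j. w {i, j})"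
      by simp
    also have "\<dots> \<le> (\<Sum>k\<in>?N i \<inter> ?N j. w {i, k} + w {k, j})"
      using N i jV by (intro sum_mono semimetric_triangle[OF w]) auto
    finally show ?thesis .
  qed
  have half: "(\<Sum>i\<in>V. \<Sum>j\<in>F i. \<Sum>k\<in>?N i \<inter> ?N j. w {i, k})
      \<le> (real (card V) - 1 - real d) * (2 * (\<Sum>e\<in>E. w e))"
  proof -
    have "(\<Sum>j\<in>F i. \<Sum>k\<in>?N i \<inter> ?N j. w {i, k})
        \<le> (real (card V) - 1 - real d) * (\<Sum>k\<in>?N i. w {i, k})" if i: "i \<in> V" for i
    proof -
      \<comment> \<open>By nonnegativity the range of \<open>k\<close> may grow to all of
        \<open>?N i\<close>; the inner sum then no longer depends on \<open>j\<close>, which leaves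
        the factor \<open>card (F i)\<close>.\<close>
      have "(\<Sum>j\<in>F i. \<Sum>k\<in>?N i \<inter> ?N j. w {i, k}) \<le> (\<Sum>j\<in>F i. \<Sum>k\<in>?N i. w {i, k})"
        using finN N i by (intro sum_mono sum_mono2 semimetric_nonneg[OF w]) auto
      then show ?thesis
        using cardF[OF i] by simp
    qed
    then have "(\<Sum>i\<in>V. \<Sum>j\<in>F i. \<Sum>k\<in>?N i \<inter> ?N j. w {i, k})
        \<le> (\<Sum>i\<in>V. (real (card V) - 1 - real d) * (\<Sum>k\<in>?N i. w {i, k}))"
      by (rule sum_mono)
    also have "\<dots> = (real (card V) - 1 - real d) * (2 * (\<Sum>e\<in>E. w e))"
      by (simp only: sum_nbrs_nsets[OF fin E] flip: sum_distrib_left)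
    finally show ?thesis .
  qed
  \<comment> \<open>Non-adjacency is symmetric, so exchanging the roles of \<open>i\<close> and
    \<open>j\<close> turns the second half of each detour into the first half.\<close>
  have swap: "(\<Sum>i\<in>V. \<Sum>j\<in>F i. \<Sum>k\<in>?N i \<inter> ?N j. w {k, j})
      = (\<Sum>i\<in>V. \<Sum>j\<in>F i. \<Sum>k\<in>?N i \<inter> ?N j. w {i, k})"
  proof -
    have F: "F i = {j \<in> V. j \<in> F i}" "{i \<in> V. j \<in> F i} = {i \<in> V. i \<in> F j}" if "j \<in> V" for i j
      using that nbrs_sym[of i E j] by (auto simp: F_def nbrs_sym)
    have "(\<Sum>i\<in>V. \<Sum>j\<in>F i. \<Sum>k\<in>?N i \<inter> ?N j. w {k, j})
        = (\<Sum>i\<in>V. \<Sum>j | j \<in> V \<and> j \<in> F i. \<Sum>k\<in>?N i \<inter> ?N j. w {k, j})"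
      using F(1) by simp
    also have "\<dots> = (\<Sum>j\<in>V. \<Sum>i | i \<in> V \<and> j \<in> F i. \<Sum>k\<in>?N i \<inter> ?N j. w {k, j})"
      using fin by (rule sum.swap_restrict) (rule fin)
    also have "\<dots> = (\<Sum>j\<in>V. \<Sum>i\<in>F j. \<Sum>k\<in>?N i \<inter> ?N j. w {k, j})"
      using F by (intro sum.cong refl) auto
    finally show ?thesis
      by (simp add: insert_commute Int_commute)
  qed
  have "(\<Sum>b\<in>V. w {a, b}) = (\<Sum>b\<in>?N a. w {a, b}) + (\<Sum>b\<in>F a. w {a, b})" if a: "a \<in> V" for a
  proof -
    have "V - {a} = ?N a \<union> F a" "?N a \<inter> F a = {}"
      using N[of a] by (auto simp: F_def)
    then have "(\<Sum>b\<in>V - {a}. w {a, b}) = (\<Sum>b\<in>?N a. w {a, b}) + (\<Sum>b\<in>F a. w {a, b})"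
      using finN by (simp add: sum.union_disjoint)
    moreover have "w {a, a} = 0"
      using w a by (simp add: semimetric_def)
    ultimately show ?thesis
      using a fin by (simp add: sum.remove[of V a])
  qed
  then have split: "2 * (\<Sum>e\<in>[V]\<^bsup>2\<^esup>. w e) = 2 * (\<Sum>e\<in>E. w e) + (\<Sum>i\<in>V. \<Sum>j\<in>F i. w {i, j})"
    using sum_all_pairs[OF fin, of w] sum_nbrs_nsets[OF fin E, of w] w
    by (simp add: semimetric_def sum.distrib)
  have "?k * (\<Sum>i\<in>V. \<Sum>j\<in>F i. w {i, j})
      \<le> (\<Sum>i\<in>V. \<Sum>j\<in>F i. \<Sum>k\<in>?N i \<inter> ?N j. w {i, k} + w {k, j})"
    unfolding sum_distrib_left by (intro sum_mono common)
  also have "\<dots> \<le> 2 * ((real (card V) - 1 - real d) * (2 * (\<Sum>e\<in>E. w e)))"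
    unfolding sum.distrib swap using half by linarith
  finally have "?k * (2 * (\<Sum>e\<in>[V]\<^bsup>2\<^esup>. w e) - 2 * (\<Sum>e\<in>E. w e))
      \<le> 2 * ((real (card V) - 1 - real d) * (2 * (\<Sum>e\<in>E. w e)))"
    using split by simp
  \<comment> \<open>The coefficients add up:
    \<open>?k + 2 * (card V - 1 - d) = card V\<close>.\<close>
  then show ?thesis
    by (simp add: algebra_simps)
qed

text \<open>An outer edge \<open>{a, b}\<close> with \<open>a\<close> in \<open>A\<close> is
  replaced by the \<open>d\<close> detours through the inner neighbours \<open>j\<close> of
  \<open>a\<close>. The parts \<open>{a, j}\<close> use every inner edge \<open>r\<close> times from
  each end; a part \<open>{j, b}\<close> arises at most \<open>r\<close> times, once for each
  possible \<open>a\<close>.\<close>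

lemma outer_regular_weight:
  assumes w: "semimetric (A \<union> B) w" and fin: "finite A" "finite B" and disj: "A \<inter> B = {}"
    and E: "E \<subseteq> [A]\<^bsup>2\<^esup>" and D: "D \<subseteq> cross_pairs A B"
    and regE: "\<And>v. v \<in> A \<Longrightarrow> card (nbrs E v) = d"
    and regD: "\<And>v. v \<in> A \<union> B \<Longrightarrow> card (nbrs D v) = r"
  shows "real d * (\<Sum>e\<in>D. w e) \<le> real r * (2 * (\<Sum>e\<in>E. w e) + (\<Sum>e\<in>cross_pairs A B. w e))"
proof -
  let ?N = "nbrs E" and ?M = "nbrs D"
  note N = nbrs_subset[OF E]
  have M: "?M a \<subseteq> B" if "a \<in> A" for a
    using that D disj by (auto simp: nbrs_def dest!: subsetD)
  have M': "?M b \<subseteq> A" if "b \<in> B" for b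
    using that D disj by (auto simp: nbrs_def dest!: subsetD)
  have finN: "finite (?N i)" for i
    using N fin finite_subset by fastforce
  have "real d * (\<Sum>e\<in>D. w e) = (\<Sum>a\<in>A. \<Sum>b\<in>?M a. real d * w {a, b})"
    by (simp only: sum_nbrs_cross[OF fin disj D] flip: sum_distrib_left)
  also have "\<dots> = (\<Sum>a\<in>A. \<Sum>b\<in>?M a. \<Sum>j\<in>?N a. w {a, b})"
    using regE by simp
  also have "\<dots> \<le> (\<Sum>a\<in>A. \<Sum>b\<in>?M a. \<Sum>j\<in>?N a. w {a, j} + w {j, b})"
    using N M by (intro sum_mono semimetric_triangle[OF w]) blast+
  also have "\<dots> = (\<Sum>a\<in>A. \<Sum>b\<in>?M a. \<Sum>j\<in>?N a. w {a, j}) + (\<Sum>a\<in>A. \<Sum>b\<in>?M a. \<Sum>j\<in>?N a. w {j, b})"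
    by (simp add: sum.distrib)
  also have "(\<Sum>a\<in>A. \<Sum>b\<in>?M a. \<Sum>j\<in>?N a. w {a, j}) = real r * (2 * (\<Sum>e\<in>E. w e))"
    using regD by (simp flip: sum_distrib_left sum_nbrs_nsets[OF fin(1) E])
  also have "(\<Sum>a\<in>A. \<Sum>b\<in>?M a. \<Sum>j\<in>?N a. w {j, b}) \<le> real r * (\<Sum>e\<in>cross_pairs A B. w e)"
  proof -
    have "(\<Sum>a\<in>A. \<Sum>b\<in>?M a. \<Sum>j\<in>?N a. w {j, b}) = (\<Sum>a\<in>A. \<Sum>j\<in>?N a. \<Sum>b\<in>?M a. w {j, b})"
      by (intro sum.cong refl sum.swap)
    \<comment> \<open>Index sets become restrictions of \<open>A\<close> and \<open>B\<close>, so
      that two exchanges can move \<open>a\<close> innermost, with the pair \<open>j\<close>,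
      \<open>b\<close> fixed.\<close>
    also have "\<dots> = (\<Sum>a\<in>A. \<Sum>j | j \<in> A \<and> j \<in> ?N a. \<Sum>b | b \<in> B \<and> b \<in> ?M a. w {j, b})"
      using N M by (intro sum.cong refl) blast+
    also have "\<dots> = (\<Sum>j\<in>A. \<Sum>a | a \<in> A \<and> j \<in> ?N a. \<Sum>b | b \<in> B \<and> b \<in> ?M a. w {j, b})"
      using fin(1) by (rule sum.swap_restrict) (rule fin(1))
    also have "\<dots> = (\<Sum>j\<in>A. \<Sum>b\<in>B. \<Sum>a | a \<in> {a \<in> A. j \<in> ?N a} \<and> b \<in> ?M a. w {j, b})"
      using fin by (intro sum.cong refl sum.swap_restrict) auto
    also have "\<dots> \<le> (\<Sum>j\<in>A. \<Sum>b\<in>B. real r * w {j, b})"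
    proof (intro sum_mono)
      fix j b assume jb: "j \<in> A" "b \<in> B"
      \<comment> \<open>Every \<open>a\<close> whose detour ends in \<open>{j, b}\<close> is a
        \<open>D\<close>-neighbour of \<open>b\<close>.\<close>
      have "{a \<in> {a \<in> A. j \<in> ?N a}. b \<in> ?M a} \<subseteq> ?M b"
        using nbrs_sym by fastforce
      moreover have "finite (?M b)"
        using M'[OF jb(2)] fin(1) finite_subset by blast
      ultimately have "card {a \<in> {a \<in> A. j \<in> ?N a}. b \<in> ?M a} \<le> r"
        using card_mono regD jb by (metis UnI2)
      then show "(\<Sum>a | a \<in> {a \<in> A. j \<in> ?N a} \<and> b \<in> ?M a. w {j, b}) \<le> real r * w {j, b}"
        using semimetric_nonneg[OF w, of j b] jb by (simp add: mult_right_mono)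
    qed
    also have "\<dots> = real r * (\<Sum>e\<in>cross_pairs A B. w e)"
      by (simp only: sum_all_cross[OF fin disj] flip: sum_distrib_left)
    finally show ?thesis .
  qed
  finally show ?thesis
    by (simp add: algebra_simps)
qed

section \<open>The degree gap forces the semimetric to vanish\<close>

text \<open>The inner bound controls \<open>C\<close> by \<open>W\<close>, and the outer bound
  controls \<open>Z\<close> by \<open>W\<close> and \<open>C\<close>. Inserting both into
  \<open>W\<close> \<le> \<open>Z\<close> gives a positive multiple of \<open>W\<close> that is at
  most 0; then \<open>W\<close>, \<open>C\<close> and finally all weights vanish.\<close>

lemma semimetric_gap:
  assumes w: "semimetric (A \<union> B) w" and fin: "finite A" "finite B" and disj: "A \<inter> B = {}"
    and card: "card A = m" "card B = m" and "0 < m"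
    and EA: "EA \<subseteq> [A]\<^bsup>2\<^esup>" and EB: "EB \<subseteq> [B]\<^bsup>2\<^esup>" and D: "D \<subseteq> cross_pairs A B"
    and regA: "\<And>v. v \<in> A \<Longrightarrow> card (nbrs EA v) = d"
    and regB: "\<And>v. v \<in> B \<Longrightarrow> card (nbrs EB v) = d"
    and regD: "\<And>v. v \<in> A \<union> B \<Longrightarrow> card (nbrs D v) = r"
    and gap: "real d - real r \<ge> real m / 2"
    and bal: "(\<Sum>e\<in>[A]\<^bsup>2\<^esup>. w e) + (\<Sum>e\<in>[B]\<^bsup>2\<^esup>. w e) = (\<Sum>e\<in>cross_pairs A B. w e)"
    and le: "(\<Sum>e\<in>EA. w e) + (\<Sum>e\<in>EB. w e) \<le> (\<Sum>e\<in>D. w e)"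
  shows "\<forall>e\<in>[A \<union> B]\<^bsup>2\<^esup>. w e = 0"
proof -
  define W where "W = (\<Sum>e\<in>EA. w e) + (\<Sum>e\<in>EB. w e)"
  define C where "C = (\<Sum>e\<in>cross_pairs A B. w e)"
  define Z where "Z = (\<Sum>e\<in>D. w e)"
  define k where "k = 2 * real d - real m + 2"
  have wA: "semimetric A w" and wB: "semimetric B w"
    using semimetric_mono[OF w] by auto
  \<comment> \<open>The inner bounds of the two sides are added; by \<open>bal\<close> the total
    inner weight equals \<open>C\<close>.\<close>
  have kC: "k * C \<le> real m * W"
    using inner_regular_weight[OF wA fin(1) EA regA] inner_regular_weight[OF wB fin(2) EB regB]
      arg_cong[OF bal, of "\<lambda>s. k * s"]
    by (simp add: card k_def C_def W_def distrib_left)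
  \<comment> \<open>Detours are taken on both sides: each side contributes its own inner edges
    twice, and \<open>Z\<close> and \<open>C\<close> once.\<close>
  have "real d * (2 * Z) \<le> real r * (2 * W + 2 * C)"
  proof -
    have "semimetric (B \<union> A) w" "B \<inter> A = {}" "D \<subseteq> cross_pairs B A"
      using w disj D by (simp_all add: Un_commute Int_commute cross_pairs_commute)
    from outer_regular_weight[OF this(1) fin(2) fin(1) this(2) EB this(3) regB, of r]
    show ?thesis
      using outer_regular_weight[OF w fin disj EA D regA regD] regD
      by (simp add: Z_def W_def C_def cross_pairs_commute[of B A] Un_commute algebra_simps)
  qed
  then have dZ: "real d * Z \<le> real r * (W + C)"
    by (simp add: algebra_simps)
  have k: "k \<ge> 2 * real r + 2" and rd: "real r < real d"
    using gap \<open>0 < m\<close> by (simp_all add: k_def)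
  have "(\<Sum>e\<in>EA. w e) \<ge> 0" "(\<Sum>e\<in>EB. w e) \<ge> 0"
    using EA EB semimetric_nonneg_nsets wA wB by (metis subsetD sum_nonneg)+
  then have W: "W \<ge> 0"
    by (simp add: W_def)
  have "real d * W * k \<le> real d * Z * k"
    using le k by (intro mult_right_mono mult_left_mono) (auto simp: W_def Z_def)
  also have "\<dots> \<le> real r * (W + C) * k"
    using dZ k by (intro mult_right_mono) auto
  also have "\<dots> = real r * (k * W) + real r * (k * C)"
    by (simp add: algebra_simps)
  also have "\<dots> \<le> real r * (k * W) + real r * (real m * W)"
    using kC by (intro add_left_mono mult_left_mono) auto
  \<comment> \<open>Here \<open>k + m = 2 * d + 2\<close>.\<close>
  also have "\<dots> = real r * (2 * real d + 2) * W"
    by (simp add: k_def algebra_simps)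
  finally have "(real d * k - real r * (2 * real d + 2)) * W \<le> 0"
    by (simp add: algebra_simps)
  \<comment> \<open>With \<open>k\<close> \<ge> \<open>2 * r + 2\<close> the difference is at least
    \<open>2 * (d - r)\<close>.\<close>
  moreover have "real d * k - real r * (2 * real d + 2) > 0"
  proof -
    have "real d * k \<ge> real d * (2 * real r + 2)"
      using k by (intro mult_left_mono) auto
    then show ?thesis
      using rd by (simp add: algebra_simps)
  qed
  ultimately have "W = 0"
    using W by (simp add: mult_le_0_iff)
  with kC k have "C \<le> 0"
    by (simp add: mult_le_0_iff)
  then have "(\<Sum>e\<in>[A \<union> B]\<^bsup>2\<^esup>. w e) \<le> 0"
    using bal by (simp add: sum_nsets_Un[OF fin disj] C_def)
  moreover have fin': "finite ([A \<union> B]\<^bsup>2\<^esup>)"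
    using fin by (intro finite_imp_finite_nsets) auto
  moreover have nn: "\<And>e. e \<in> [A \<union> B]\<^bsup>2\<^esup> \<Longrightarrow> 0 \<le> w e"
    using semimetric_nonneg_nsets[OF w] .
  ultimately show ?thesis
    using sum_nonneg_eq_0_iff[OF fin', of w] sum_nonneg[of "[A \<union> B]\<^bsup>2\<^esup>" w] by force
qed

section \<open>Constraints of the linear program and feasibility of the cut vector\<close>

lemma lp_triangle:
  assumes "x \<in> lp_feasible n" "i \<in> {1..n}" "j \<in> {1..n}" "k \<in> {1..n}" "distinct [i, j, k]"
  shows "x {i, j} \<le> x {i, k} + x {k, j}"
proof -
  have *: "x {a, b} \<le> x {a, c} + x {b, c}"
    if "a \<in> {1..n}" "b \<in> {1..n}" "c \<in> {1..n}" "a < b" "c \<noteq> a" "c \<noteq> b" for a b c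
    using assms(1) that unfolding lp_feasible_def by blast
  show ?thesis
    using *[of i j k] *[of j i k] assms(2-) by (cases "i < j") (auto simp: insert_commute)
qed

lemma lp_perimeter:
  assumes "x \<in> lp_feasible n" "i \<in> {1..n}" "j \<in> {1..n}" "k \<in> {1..n}" "distinct [i, j, k]"
  shows "x {i, j} + x {i, k} + x {j, k} \<le> 2"
proof -
  have *: "x {a, b} + x {a, c} + x {b, c} \<le> 2"
    if "a \<in> {1..n}" "b \<in> {1..n}" "c \<in> {1..n}" "a < b" "b < c" for a b c
    using assms(1) that unfolding lp_feasible_def by blast
  consider "i < j \<and> j < k" | "i < k \<and> k < j" | "j < i \<and> i < k"
    | "j < k \<and> k < i" | "k < i \<and> i < j" | "k < j \<and> j < i"
    using assms(5) by fastforce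
  then show ?thesis
    using *[of i j k] *[of i k j] *[of j i k] *[of j k i] *[of k i j] *[of k j i] assms(2-4)
    by cases (auto simp: insert_commute)
qed

lemma cut_vector_pair:
  assumes "i \<in> A \<union> B" "j \<in> A \<union> B" "i \<noteq> j" "A \<inter> B = {}" "A \<union> B = {1..n}"
  shows "cut_vector n A B {i, j} = (if i \<in> A \<longleftrightarrow> j \<in> A then 0 else 1)"
proof -
  have "{i, j} \<in> [{1..n}]\<^bsup>2\<^esup>"
    using assms by (simp add: nsets_def flip: assms(5))
  then show ?thesis
    using assms by (auto simp: cut_vector_def)
qed

lemma cut_vector_nsets:
  assumes "A \<inter> B = {}" "A \<union> B = {1..n}"
  shows "e \<in> [A]\<^bsup>2\<^esup> \<Longrightarrow> cut_vector n A B e = 0"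
    and "e \<in> [B]\<^bsup>2\<^esup> \<Longrightarrow> cut_vector n A B e = 0"
    and "e \<in> cross_pairs A B \<Longrightarrow> cut_vector n A B e = 1"
proof -
  have "e \<in> [{1..n}]\<^bsup>2\<^esup>" if "e \<in> [A]\<^bsup>2\<^esup> \<or> e \<in> [B]\<^bsup>2\<^esup> \<or> e \<in> cross_pairs A B"
    using that nsets_Un_2[OF assms(1)] assms(2) by auto
  then show "e \<in> [A]\<^bsup>2\<^esup> \<Longrightarrow> cut_vector n A B e = 0"
    and "e \<in> [B]\<^bsup>2\<^esup> \<Longrightarrow> cut_vector n A B e = 0"
    and "e \<in> cross_pairs A B \<Longrightarrow> cut_vector n A B e = 1"
    using assms(1) by (auto simp: cut_vector_def) (auto simp: nsets_def elim!: cross_pairsE)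
qed

text \<open>Exactly the \<open>card A * card B\<close> crossing pairs count, and both sides have
  \<open>n / 2\<close> nodes.\<close>

lemma cut_vector_sum:
  assumes "A \<inter> B = {}" "A \<union> B = {1..n}" "card A = card B"
  shows "(\<Sum>e\<in>[{1..n}]\<^bsup>2\<^esup>. cut_vector n A B e) = (real n)\<^sup>2 / 4"
proof -
  have fin: "finite A" "finite B"
    using assms(2) by (metis finite_Un finite_atLeastAtMost)+
  have "card (A \<union> B) = card A + card B"
    using fin assms(1) by (rule card_Un_disjoint)
  then have n: "real n = 2 * real (card A)"
    using assms by simp
  have "(\<Sum>e\<in>[{1..n}]\<^bsup>2\<^esup>. cut_vector n A B e) = (\<Sum>e\<in>cross_pairs A B. 1)"
    using sum_nsets_Un[OF fin assms(1), of "cut_vector n A B"] cut_vector_nsets[OF assms(1,2)]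
    by (simp add: assms(2))
  also have "\<dots> = (\<Sum>a\<in>A. \<Sum>b\<in>B. 1)"
    by (rule sum_all_cross[OF fin assms(1), symmetric])
  also have "\<dots> = (real n)\<^sup>2 / 4"
    using n assms(3) by (simp add: power2_eq_square)
  finally show ?thesis .
qed

text \<open>Among the three pairs of a triple, the cut separates either none or exactly two; both
  kinds of inequality hold in each case.\<close>

lemma cut_vector_feasible:
  assumes "A \<inter> B = {}" "A \<union> B = {1..n}" "card A = card B"
  shows "cut_vector n A B \<in> lp_feasible n"
proof -
  note c = cut_vector_pair[OF _ _ _ assms(1,2), unfolded assms(2)]
  have "cut_vector n A B \<in> pair_vectors n"
    by (simp add: pair_vectors_def cut_vector_def)
  then show ?thesis
    unfolding lp_feasible_def using cut_vector_sum[OF assms] by (simp add: c)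
qed

section \<open>Switching along the planted cut\<close>

text \<open>If the cut isolates one node of a triple, the two coordinates at that node are switched.
  The triangle inequality for \<open>w\<close> is then the perimeter inequality for \<open>x\<close>
  when \<open>k\<close> is isolated, and another triangle inequality for \<open>x\<close> when
  \<open>i\<close> or \<open>j\<close> is. The value 0 off the pairs supplies
  \<open>w {v} = 0\<close>.\<close>

lemma switched_semimetric:
  fixes x :: "nat set \<Rightarrow> real"
  assumes x: "x \<in> lp_feasible n" and AB: "A \<inter> B = {}" "A \<union> B = {1..n}" and n: "3 \<le> n"
  defines "w \<equiv> \<lambda>e. if e \<in> [{1..n}]\<^bsup>2\<^esup> then
      (if e \<in> cross_pairs A B then 1 - x e else x e) else 0"
  shows "semimetric {1..n} w"
proof -
  have ws: "w {v} = 0" for v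
    by (simp add: w_def nsets_def)
  have wp: "w {i, j} = (if i \<in> A \<longleftrightarrow> j \<in> A then x {i, j} else 1 - x {i, j})"
    if "i \<in> {1..n}" "j \<in> {1..n}" "i \<noteq> j" for i j
  proof -
    have "{i, j} \<in> [{1..n}]\<^bsup>2\<^esup>"
      using that by (simp add: nsets_def)
    moreover have "{i, j} \<in> cross_pairs A B \<longleftrightarrow> \<not> (i \<in> A \<longleftrightarrow> j \<in> A)"
      using that AB by auto
    ultimately show ?thesis
      by (simp add: w_def)
  qed
  have tri: "w {i, j} \<le> w {i, k} + w {k, j}"
    if "i \<in> {1..n}" "j \<in> {1..n}" "k \<in> {1..n}" "distinct [i, j, k]" for i j k
    using that lp_triangle[OF x, of i j k] lp_triangle[OF x, of i k j] lp_triangle[OF x, of k j i]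
      lp_perimeter[OF x, of i j k]
    by (simp add: wp insert_commute)
  \<comment> \<open>Two triangle inequalities through a third node \<open>k\<close> add up to
    \<open>0\<close> \<le> \<open>2 * w {i, j}\<close>; such a node exists because \<open>n\<close>
    \<ge> 3.\<close>
  have nn: "0 \<le> w {i, j}" if ij: "i \<in> {1..n}" "j \<in> {1..n}" "i \<noteq> j" for i j
  proof -
    have "card {i, j} < card {1..n}"
      using n ij(3) by simp
    then obtain k where k: "k \<in> {1..n}" "k \<notin> {i, j}"
      by (metis card_mono finite.emptyI finite_insert linorder_not_le subsetI)
    then show ?thesis
      using tri[of i k j] tri[of j k i] ij by (simp add: insert_commute)
  qed
  have "w {i, j} \<le> w {i, k} + w {k, j}"
    if "i \<in> {1..n}" "j \<in> {1..n}" "k \<in> {1..n}" for i j k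
  proof (cases "distinct [i, j, k]")
    case True
    then show ?thesis
      using tri that by blast
  next
    case False
    then consider "i = j" "i \<noteq> k" | "i = k" | "j = k"
      by auto
    then show ?thesis
      using nn[of i k] that by cases (auto simp: ws insert_commute)
  qed
  with ws show ?thesis
    by (auto simp: semimetric_def)
qed

section \<open>Comparing objective values and recovery\<close>

text \<open>In terms of \<open>w\<close>, the change of the objective is the weight of the edges of
  \<open>G\<close> inside the parts minus the weight of those across. As \<open>w\<close> is
  nonnegative, passing to \<open>HA\<close> and \<open>HB\<close> inside and to \<open>H0\<close>
  across keeps the inequality, and \<open>semimetric_gap\<close> applies.\<close>

lemma objective_gap_zero:
  assumes G: "simple_graph G" "verts G = {1..n}"
    and AB: "A \<inter> B = {}" "A \<union> B = {1..n}" and m: "card A = m" "card B = m" "0 < m"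
    and HA: "subgraph HA (induced_subgraph G A)" "verts HA = A" "regular d HA"
    and HB: "subgraph HB (induced_subgraph G B)" "verts HB = B" "regular d HB"
    and H0: "subgraph (between_graph G A B) H0" "bipartite_with A B H0" "regular r H0"
    and gap: "real d - real r \<ge> real m / 2"
    and x: "x \<in> lp_feasible n" and le: "lp_objective n G x \<le> lp_objective n G (cut_vector n A B)"
  shows "x = cut_vector n A B"
proof -
  define w where "w = (\<lambda>e. if e \<in> [{1..n}]\<^bsup>2\<^esup> then
      (if e \<in> cross_pairs A B then 1 - x e else x e) else 0)"
  have fin: "finite A" "finite B"
    using AB(2) by (metis finite_Un finite_atLeastAtMost)+
  have n: "n = 2 * m"
    using card_Un_disjoint[OF fin AB(1)] AB(2) m by simp
  have EA: "edges HA \<subseteq> [A]\<^bsup>2\<^esup>" "edges HA \<subseteq> edges G" and sHA: "simple_graph HA"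
    using HA by (auto simp: subgraph_def induced_subgraph_def simple_graph_def)
  have EB: "edges HB \<subseteq> [B]\<^bsup>2\<^esup>" "edges HB \<subseteq> edges G" and sHB: "simple_graph HB"
    using HB by (auto simp: subgraph_def induced_subgraph_def simple_graph_def)
  have D: "edges H0 \<subseteq> cross_pairs A B" "simple_graph H0" "verts H0 = A \<union> B"
    using H0(2) by (auto simp: bipartite_with_def)
  have G0: "edges G \<inter> cross_pairs A B \<subseteq> edges H0"
    using H0(1) by (auto simp: subgraph_def between_graph_def elim!: cross_pairsE)
  have regA: "card (nbrs (edges HA) v) = d" if "v \<in> A" for v
    using that HA by (simp add: card_nbrs[OF sHA] regular_def)
  have regB: "card (nbrs (edges HB) v) = d" if "v \<in> B" for v
    using that HB by (simp add: card_nbrs[OF sHB] regular_def)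
  have regD: "card (nbrs (edges H0) v) = r" if "v \<in> A \<union> B" for v
    using that D H0(3) by (simp add: card_nbrs regular_def)
  \<comment> \<open>A \<open>d\<close>-regular graph on \<open>m\<close> nodes has \<open>d\<close>
    \<le> \<open>m - 1\<close>; with \<open>d\<close> \<ge> \<open>m / 2\<close> this gives
    \<open>m\<close> \<ge> 2, hence \<open>n\<close> \<ge> 4.\<close>
  have "3 \<le> n"
  proof -
    obtain v where v: "v \<in> A"
      using m by fastforce
    have "card (nbrs (edges HA) v) \<le> card (A - {v})"
      using nbrs_subset[OF EA(1)] fin by (intro card_mono) auto
    then have "d \<le> m - 1"
      using regA v m by simp
    then show ?thesis
      using gap m(3) n by linarith
  qed
  then have w: "semimetric (A \<union> B) w"
    using switched_semimetric[OF x AB] by (simp add: w_def AB(2))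
  have diff: "x e - cut_vector n A B e = (if e \<in> cross_pairs A B then - w e else w e)"
    if "e \<in> [{1..n}]\<^bsup>2\<^esup>" for e
    using that nsets_Un_2[OF AB(1)] cut_vector_nsets[OF AB, of e] AB(2) by (auto simp: w_def)
  have disj: "e \<notin> cross_pairs A B" if "e \<in> [A]\<^bsup>2\<^esup> \<or> e \<in> [B]\<^bsup>2\<^esup>" for e
    using that AB(1) by (auto simp: nsets_def elim!: cross_pairsE)
  have bal: "(\<Sum>e\<in>[A]\<^bsup>2\<^esup>. w e) + (\<Sum>e\<in>[B]\<^bsup>2\<^esup>. w e) = (\<Sum>e\<in>cross_pairs A B. w e)"
  proof -
    \<comment> \<open>Both vectors have coordinate sum \<open>n^2 / 4\<close>.\<close>
    have "(\<Sum>e\<in>[{1..n}]\<^bsup>2\<^esup>. x e - cut_vector n A B e) = 0"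
      using x cut_vector_sum[OF AB] m by (simp add: lp_feasible_def sum_subtractf)
    then have "(\<Sum>e\<in>[A \<union> B]\<^bsup>2\<^esup>. if e \<in> cross_pairs A B then - w e else w e) = 0"
      using diff by (simp add: AB(2) cong: sum.cong)
    then show ?thesis
      using disj by (simp add: sum_nsets_Un[OF fin AB(1)] sum_negf cong: sum.cong)
  qed
  have finP: "finite ([{1..n}]\<^bsup>2\<^esup>)"
    by (intro finite_imp_finite_nsets) auto
  have GP: "edges G \<subseteq> [{1..n}]\<^bsup>2\<^esup>"
    using G by (simp add: simple_graph_def)
  have finG: "finite (edges G)"
    using GP finP finite_subset by blast
  have nn: "0 \<le> w e" if "e \<in> [{1..n}]\<^bsup>2\<^esup>" for e
    using semimetric_nonneg_nsets[OF w] that AB(2) by simp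
  have "(\<Sum>e\<in>edges HA. w e) + (\<Sum>e\<in>edges HB. w e) \<le> (\<Sum>e\<in>edges H0. w e)"
  proof -
    have obj: "lp_objective n G y = (\<Sum>e\<in>edges G. y e)" for y
    proof -
      have "lp_objective n G y = (\<Sum>e\<in>[{1..n}]\<^bsup>2\<^esup>. if e \<in> edges G then y e else 0)"
        unfolding lp_objective_def by (intro sum.cong) auto
      also have "\<dots> = (\<Sum>e\<in>edges G. y e)"
        using GP finP by (simp add: sum.If_cases Int_absorb1)
      finally show ?thesis .
    qed
    have "(\<Sum>e\<in>edges G. if e \<in> cross_pairs A B then - w e else w e)
        = (\<Sum>e\<in>edges G. x e - cut_vector n A B e)"
      using GP diff by (intro sum.cong refl) (metis subsetD)
    also have "\<dots> \<le> 0"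
      using le by (simp add: obj sum_subtractf)
    finally have "(\<Sum>e\<in>edges G - cross_pairs A B. w e) \<le> (\<Sum>e\<in>edges G \<inter> cross_pairs A B. w e)"
      using finG by (simp add: sum.If_cases sum_negf Diff_eq)
    also have "\<dots> \<le> (\<Sum>e\<in>edges H0. w e)"
    proof -
      have "edges H0 \<subseteq> [{1..n}]\<^bsup>2\<^esup>"
        using D AB(2) by (simp add: simple_graph_def)
      then show ?thesis
        using G0 nn finP finite_subset by (intro sum_mono2) blast+
    qed
    also have "(\<Sum>e\<in>edges HA. w e) + (\<Sum>e\<in>edges HB. w e) = (\<Sum>e\<in>edges HA \<union> edges HB. w e)"
    proof -
      have "edges HA \<inter> edges HB = {}"
        using nsets_disjoint_2[OF AB(1)] EA EB by blast
      then show ?thesis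
        using EA EB finG finite_subset by (metis sum.union_disjoint)
    qed
    moreover have "(\<Sum>e\<in>edges HA \<union> edges HB. w e) \<le> (\<Sum>e\<in>edges G - cross_pairs A B. w e)"
      using EA EB disj finG GP nn by (intro sum_mono2) blast+
    ultimately show ?thesis
      by linarith
  qed
  from semimetric_gap[OF w fin AB(1) m EA(1) EB(1) D(1) regA regB regD gap bal this]
  have "x e = cut_vector n A B e" if "e \<in> [{1..n}]\<^bsup>2\<^esup>" for e
    using diff[OF that] that AB(2) by (auto split: if_splits)
  moreover have "x \<in> pair_vectors n" "cut_vector n A B \<in> pair_vectors n"
    using x cut_vector_feasible[OF AB] m by (auto simp: lp_feasible_def)
  ultimately show ?thesis
    unfolding pair_vectors_def by (intro PiE_ext) auto
qed

theorem theorem4: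
  fixes n :: nat and G G0 G1 G2 :: "nat ugraph" and V1 V2 :: "nat set" and d_in d_out :: nat
  assumes "simple_graph G" and "verts G = {1..n}"
    and "bisection {1..n} V1 V2"
    and "G1 = induced_subgraph G V1"
    and "G2 = induced_subgraph G V2"
    and "G0 = between_graph G V1 V2"
    and "d_in = min_degree (graph_union G1 G2)"
    and "d_out = max_degree G0"
    and "\<exists>H. subgraph H G1 \<and> verts H = V1 \<and> regular d_in H"
    and "\<exists>H. subgraph H G2 \<and> verts H = V2 \<and> regular d_in H"
    and "\<exists>H. subgraph G0 H \<and> bipartite_with V1 V2 H \<and> regular d_out H"
    and "real d_in - real d_out \<ge> real n / 4"
  shows "lp_recovers n G V1 V2"
proof -
  obtain H1 where H1: "subgraph H1 (induced_subgraph G V1)" "verts H1 = V1" "regular d_in H1"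
    using assms by blast
  obtain H2 where H2: "subgraph H2 (induced_subgraph G V2)" "verts H2 = V2" "regular d_in H2"
    using assms by blast
  obtain H0 where H0: "subgraph (between_graph G V1 V2) H0" "bipartite_with V1 V2 H0" "regular d_out H0"
    using assms by blast
  have V: "V1 \<inter> V2 = {}" "V1 \<union> V2 = {1..n}" "card V1 = card V2" "V1 \<noteq> {}"
    using assms(3) by (auto simp: bisection_def)
  have fin: "finite V1" "finite V2"
    using V(2) by (metis finite_Un finite_atLeastAtMost)+
  have "n = 2 * card V1"
    using card_Un_disjoint[OF fin V(1)] V(2,3) by simp
  then have gap: "real d_in - real d_out \<ge> real (card V1) / 2"
    using assms(12) by simp
  have "0 < card V1"
    using fin V(4) by (simp add: card_gt_0_iff)
  note unique = objective_gap_zero[OF assms(1,2) V(1,2) refl V(3)[symmetric] this H1 H2 H0 gap]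
  note feas = cut_vector_feasible[OF V(1-3)]
  \<comment> \<open>A feasible vector whose objective is at most that of the cut vector equals it,
    so no feasible vector does better; the same fact then gives uniqueness.\<close>
  have "lp_optimal n G (cut_vector n V1 V2)"
    unfolding lp_optimal_def using feas unique by (metis linorder_le_cases order_refl)
  moreover have "y = cut_vector n V1 V2" if "lp_optimal n G y" for y
    using that feas unique by (simp add: lp_optimal_def)
  ultimately show ?thesis
    unfolding lp_recovers_def by blast
qed

end
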